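(* There exists $n_0$ such that for all $n \ge n_0$ the following holds. Let $r < n/2 - 7$, let $L_1, L_2, L_3 \colon \mathbb{F}_2^n \to \mathbb{F}_2^n$ be invertible linear maps, and let $x_1, x_2, x_3 \in \mathbb{F}_2^n$. Then $L_1 B_r(x_1) \cup L_2 B_r(x_2) \cup L_3 B_r(x_3) \neq \mathbb{F}_2^n$; that is, $\mathbb{F}_2^n$ cannot be covered by three Hamming balls of radius $r$ relative to different bases.
   Context: For $x, y \in \mathbb{F}_2^n$, $d(x,y)$ denotes the Hamming distance, i.e. the number of indices $i \in \{1,\dots,n\}$ with $x_i \neq y_i$. For a real number $r$, $B_r(x) = \{y \in \mathbb{F}_2^n : d(x,y) \le r\}$ is the Hamming ball of radius $r$ around $x$. For a linear map $L \colon \mathbb{F}_2^n \to \mathbb{F}_2^n$, $L B_r(x) = \{Ly : y \in B_r(x)\}$; for invertible $L$ this is a Hamming ball of radius $r$ relative to the basis given by the columns of the matrix of $L$. *)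

theory Defs
  imports "Jordan_Normal_Form.VS_Connect" "HOL-Library.Z2"
begin

definition hamming_dist :: "'a vec \<Rightarrow> 'a vec \<Rightarrow> nat" where
  "hamming_dist x y = card {i. i < dim_vec x \<and> x $ i \<noteq> y $ i}"

definition hamming_ball :: "real \<Rightarrow> 'a vec \<Rightarrow> 'a vec set" where
  "hamming_ball r x = {y \<in> carrier_vec (dim_vec x). real (hamming_dist x y) \<le> r}"

definition invertible_linear_map :: "nat \<Rightarrow> ('a :: field vec \<Rightarrow> 'a vec) \<Rightarrow> bool" where
  "invertible_linear_map n L \<longleftrightarrow>
     linear_map class_ring (module_vec TYPE('a) n) (module_vec TYPE('a) n) L \<and>
     bij_betw L (carrier_vec n) (carrier_vec n)"

end

theory Submission
  imports Defs "HOL-Library.Function_Algebras"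
begin

text \<open>
  Write \<open>a\<^sub>j\<close> and \<open>b\<^sub>j\<close> for the coordinate functionals of the first two bases and \<open>u\<close> for the sum
  of the third basis. Adding \<open>u\<close> to a point flips all of its coordinates in the third basis, so one
  of \<open>v\<close>, \<open>v + u\<close> is at distance at least \<open>n/2\<close> from the third centre. It remains to find \<open>v\<close> such
  that both \<open>v\<close> and \<open>v + u\<close> are at distance at least \<open>n/2 - 7\<close> from the first two centres. Split the
  \<open>a\<^sub>j\<close> into two classes according to the value \<open>a\<^sub>j u\<close>, and likewise the \<open>b\<^sub>j\<close>. Suppose that disjoint
  pairs are chosen inside the classes such that all the sums \<open>a\<^sub>i + a\<^sub>j\<close> and \<open>b\<^sub>i + b\<^sub>j\<close> over the chosen
  pairs are linearly independent. Then these sums can be prescribed at \<open>v\<close> so that in every pair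
  exactly one coordinate differs from the centre, at \<open>v\<close> and hence at \<open>v + u\<close>.

  At least \<open>n - 7\<close> pairs can be chosen, so that at least \<open>n/2 - 7\<close> of them lie on either side. Let \<open>D\<close>
  be the span of the sums of a maximal choice. A class with three unpaired elements lies in a single
  coset of \<open>D\<close>, as otherwise one pair could be replaced by two. Re-pairing two pairs of the same class
  that lie in different cosets of \<open>D\<close> yields another maximal choice. Comparing all these choices
  shows that \<open>D\<close> contains too many independent vectors if fewer than \<open>n - 7\<close> pairs are used.
\<close>

section \<open>Linear algebra over the field with two elements\<close>

locale binary_vector_space = Vector_Spaces.vector_space scale
  for scale :: "bit \<Rightarrow> 'b::ab_group_add \<Rightarrow> 'b"
begin

lemma add_self [simp]: "(y :: 'b) + y = 0"
proof -
  have "scale (1 + 1) y = scale 1 y + scale 1 y"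
    by (rule scale_left_distrib)
  then show ?thesis by simp
qed

lemma add_self_left [simp]: "(y :: 'b) + (y + z) = z"
  by (simp flip: add.assoc)

lemma diff_eq_add: "(y :: 'b) - z = y + z"
  using add_diff_cancel_left'[of z "y + z"] by (simp add: ac_simps)

text \<open>The only scalars are 0 and 1, so the new generator occurs either not at all or
  once.\<close>

lemma span_insert_iff: "y \<in> span (insert a S) \<longleftrightarrow> y \<in> span S \<or> y + a \<in> span S"
proof -
  have "(\<exists>k. P (scale k a)) \<longleftrightarrow> P 0 \<or> P a" for P
    by (metis (full_types) bit_not_zero_iff scale_one scale_zero_left)
  from this[of "\<lambda>z. y - z \<in> span S"] show ?thesis
    by (simp add: span_breakdown_eq diff_eq_add)
qed

text \<open>Lets the coordinates of a vector in the span be read as a subset of the index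
  set.\<close>

lemma span_image_subset_sums:
  assumes "finite M"
  shows "span (f ` M) = sum f ` Pow M"
  using assms
proof (induction M)
  case empty
  then show ?case by simp
next
  case (insert p M)
  have *: "sum f (insert p T) = f p + sum f T" if "T \<subseteq> M" for T
    using insert.hyps that by (subst sum.insert) (auto intro: finite_subset)
  have "y + f p \<in> sum f ` Pow M \<longleftrightarrow> y \<in> sum f ` insert p ` Pow M" for y
  proof
    assume "y + f p \<in> sum f ` Pow M"
    then obtain T where T: "T \<subseteq> M" "y + f p = sum f T" by auto
    have "y = f p + (y + f p)" by (simp add: ac_simps)
    also have "\<dots> = sum f (insert p T)" using T * by simp
    finally show "y \<in> sum f ` insert p ` Pow M" using T by blast
  next
    assume "y \<in> sum f ` insert p ` Pow M"
    then obtain T where T: "T \<subseteq> M" "y = sum f (insert p T)" by auto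
    then have "y + f p = sum f T" using * by (simp add: ac_simps)
    then show "y + f p \<in> sum f ` Pow M" using T by blast
  qed
  then show ?case
    by (auto simp: span_insert_iff insert.IH Pow_insert image_Un)
qed

text \<open>Injectivity rules out repeated vectors, so that a finite index set has as many elements
  as the dimension of the span.\<close>

definition independent_family :: "('k \<Rightarrow> 'b) \<Rightarrow> 'k set \<Rightarrow> bool" where
  "independent_family f M \<longleftrightarrow> inj_on f M \<and> independent (f ` M)"

lemma independent_family_mono: "independent_family f M \<Longrightarrow> N \<subseteq> M \<Longrightarrow> independent_family f N"
  unfolding independent_family_def by (meson image_mono independent_mono inj_on_subset)

lemma independent_family_insert:
  assumes "independent_family f M" and "f p \<notin> span (f ` M)"
  shows "independent_family f (insert p M)"
proof -
  have "f p \<notin> f ` M" using assms(2) span_base by blast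
  then show ?thesis
    using assms independent_insertI[of "f p" "f ` M"] unfolding independent_family_def
    by (auto intro: inj_on_insert[THEN iffD2])
qed

lemma independent_family_notin_span:
  assumes "independent_family f M" and "p \<in> M"
  shows "f p \<notin> span (f ` (M - {p}))"
proof -
  have "f ` (M - {p}) = f ` M - {f p}"
    using assms unfolding independent_family_def inj_on_def by blast
  then show ?thesis
    using assms unfolding independent_family_def dependent_def by auto
qed

lemma independent_family_card_le:
  assumes "independent_family f M" and "finite T" and "f ` M \<subseteq> span T"
  shows "card M \<le> card T"
  using independent_span_bound[of T "f ` M"] assms card_image[of f M]
  unfolding independent_family_def by simp

lemma independent_family_subset_sum_inj:
  assumes M: "independent_family f M" "finite M" and "S \<subseteq> M" "T \<subseteq> M" "sum f S = sum f T"
  shows "S \<subseteq> T"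
proof
  fix p assume p: "p \<in> S"
  show "p \<in> T"
  proof (rule ccontr)
    assume "p \<notin> T"
    have "finite S" using assms finite_subset by blast
    then have "sum f S = f p + sum f (S - {p})" using p by (simp add: sum.remove)
    then have "f p = sum f T + sum f (S - {p})" using assms(5) by (simp add: ac_simps)
    moreover have "sum f T \<in> span (f ` (M - {p}))" "sum f (S - {p}) \<in> span (f ` (M - {p}))"
      using \<open>p \<notin> T\<close> assms(3,4) by (auto intro!: span_sum intro: span_base)
    ultimately have "f p \<in> span (f ` (M - {p}))" using span_add by metis
    then show False using independent_family_notin_span[OF M(1)] p assms by blast
  qed
qed

end

section \<open>Pairings with independent differences\<close>

text \<open>In the application \<open>x i\<close> runs through the coordinate functionals of two
  bases, \<open>fst (cls i)\<close> tells the basis and \<open>snd (cls i)\<close> the value at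
  \<open>u\<close>. Each side is independent by itself; dependencies between the sides are
  allowed.\<close>

locale two_sided_pairing = binary_vector_space scale
  for scale :: "bit \<Rightarrow> 'b::ab_group_add \<Rightarrow> 'b" +
  fixes I :: "'i set" and x :: "'i \<Rightarrow> 'b" and cls :: "'i \<Rightarrow> bool \<times> bool" and n :: nat
  assumes finite_I: "finite I"
    and card_side: "\<And>s. card {i \<in> I. fst (cls i) = s} = n"
    and independent_side: "\<And>s. independent_family x {i \<in> I. fst (cls i) = s}"
begin

definition block :: "bool \<times> bool \<Rightarrow> 'i set" where
  "block k = {i \<in> I. cls i = k}"

definition matching :: "'i set set \<Rightarrow> bool" where
  "matching M \<longleftrightarrow>
     (\<forall>p\<in>M. \<exists>i j. p = {i, j} \<and> i \<noteq> j \<and> i \<in> I \<and> j \<in> I \<and> cls i = cls j) \<and>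
     (\<forall>p\<in>M. \<forall>q\<in>M. p \<noteq> q \<longrightarrow> p \<inter> q = {})"

definition good :: "'i set set \<Rightarrow> bool" where
  "good M \<longleftrightarrow> matching M \<and> independent_family (sum x) M"

abbreviation D :: "'i set set \<Rightarrow> 'b set" where
  "D M \<equiv> span (sum x ` M)"

lemma matching_pair:
  assumes "matching M" "p \<in> M"
  shows "\<exists>i j. p = {i, j} \<and> i \<noteq> j \<and> i \<in> I \<and> j \<in> I \<and> cls i = cls j"
  using assms unfolding matching_def by simp

lemma matching_disjoint:
  assumes "matching M" "p \<in> M" "q \<in> M" "p \<noteq> q"
  shows "p \<inter> q = {}"
  using assms unfolding matching_def by simp

lemma matchingE:
  assumes "matching M" "p \<in> M" "i \<in> p"
  obtains j where "p = {i, j}" "j \<noteq> i" "i \<in> I" "j \<in> I" "cls j = cls i"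
proof -
  obtain a b where ab: "p = {a, b}" "a \<noteq> b" "a \<in> I" "b \<in> I" "cls a = cls b"
    using matching_pair[OF assms(1,2)] by iprover
  show ?thesis
  proof (cases "i = a")
    case True
    with ab show ?thesis by (intro that[of b]) auto
  next
    case False
    with ab assms(3) show ?thesis by (intro that[of a]) auto
  qed
qed

lemma matching_nonempty: "matching M \<Longrightarrow> p \<in> M \<Longrightarrow> \<exists>i. i \<in> p"
  using matching_pair by fastforce

lemma matching_mono:
  assumes "matching M" "N \<subseteq> M"
  shows "matching N"
  unfolding matching_def
proof (intro conjI ballI impI)
  fix p assume "p \<in> N"
  then show "\<exists>i j. p = {i, j} \<and> i \<noteq> j \<and> i \<in> I \<and> j \<in> I \<and> cls i = cls j"
    using assms by (intro matching_pair[OF assms(1)]) auto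
next
  fix p q assume "p \<in> N" "q \<in> N" "p \<noteq> q"
  then show "p \<inter> q = {}"
    using assms by (intro matching_disjoint[OF assms(1)]) auto
qed

lemma good_mono: "good M \<Longrightarrow> N \<subseteq> M \<Longrightarrow> good N"
  unfolding good_def by (meson independent_family_mono matching_mono)

lemma matching_subset_Pow: "matching M \<Longrightarrow> M \<subseteq> Pow I"
  using matchingE by blast

lemma finite_matching: "matching M \<Longrightarrow> finite M"
  using matching_subset_Pow finite_I finite_subset by blast

lemma finite_good: "good M \<Longrightarrow> finite M"
  unfolding good_def using finite_matching by blast

lemma matching_insert:
  assumes "matching M" "i \<noteq> j" "i \<in> I" "j \<in> I" "cls i = cls j" "i \<notin> \<Union>M" "j \<notin> \<Union>M"
  shows "matching (insert {i, j} M)"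
proof -
  have disj: "{i, j} \<inter> q = {}" if "q \<in> M" for q using assms(6,7) that by blast
  have "\<exists>a b. p = {a, b} \<and> a \<noteq> b \<and> a \<in> I \<and> b \<in> I \<and> cls a = cls b"
    if "p \<in> insert {i, j} M" for p
  proof (cases "p = {i, j}")
    case True
    with assms(2-5) show ?thesis by (intro exI[of _ i] exI[of _ j]) simp
  next
    case False
    with that show ?thesis by (intro matching_pair[OF assms(1)]) simp
  qed
  moreover have "p \<inter> q = {}" if pq: "p \<in> insert {i, j} M" "q \<in> insert {i, j} M" "p \<noteq> q" for p q
  proof -
    consider "p = {i, j}" "q \<in> M" | "q = {i, j}" "p \<in> M" | "p \<in> M" "q \<in> M"
      using pq by auto
    then show ?thesis
    proof cases
      case 1
      then show ?thesis using disj by simp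
    next
      case 2
      then show ?thesis using disj[of p] by (simp add: Int_commute)
    next
      case 3
      then show ?thesis using matching_disjoint[OF assms(1)] pq(3) by simp
    qed
  qed
  ultimately show ?thesis unfolding matching_def by (intro conjI ballI impI)
qed

lemma pair_in_D:
  assumes "{b, b'} \<in> M" "b \<noteq> b'"
  shows "x b + x b' \<in> D M"
proof -
  have "sum x {b, b'} \<in> D M" using assms(1) by (intro span_base imageI)
  then show ?thesis using assms(2) by simp
qed

lemma good_insert:
  assumes "good M" "i \<noteq> j" "i \<in> I" "j \<in> I" "cls i = cls j" "i \<notin> \<Union>M" "j \<notin> \<Union>M"
    and "x i + x j \<notin> D M"
  shows "good (insert {i, j} M)" "card (insert {i, j} M) = Suc (card M)"
proof -
  have "{i, j} \<notin> M" using assms by blast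
  then show "card (insert {i, j} M) = Suc (card M)"
    using finite_good[OF assms(1)] by simp
  show "good (insert {i, j} M)"
    using assms matching_insert[of M i j] independent_family_insert[of "sum x" M "{i, j}"]
    unfolding good_def by simp
qed

text \<open>Over the field with two elements, two vectors are independent modulo \<open>D N\<close>
  exactly when neither they nor their sum lie in \<open>D N\<close>.\<close>

lemma good_insert_two:
  assumes N: "good N" and dist: "distinct [b, b', c, c']"
    and in_I: "{b, b', c, c'} \<subseteq> I" and unc: "{b, b', c, c'} \<inter> \<Union>N = {}"
    and cls: "cls b = cls c" "cls b' = cls c'"
    and D1: "x b + x c \<notin> D N" and D2: "x b' + x c' \<notin> D N"
    and D3: "(x b + x c) + (x b' + x c') \<notin> D N"
  shows "good (insert {b', c'} (insert {b, c} N))"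
    and "card (insert {b', c'} (insert {b, c} N)) = card N + 2"
proof -
  have 1: "good (insert {b, c} N)" "card (insert {b, c} N) = Suc (card N)"
    using good_insert[of N b c] assms by auto
  have "x b' + x c' \<notin> D (insert {b, c} N)"
    using D2 D3 dist by (simp add: span_insert_iff ac_simps)
  then have "good (insert {b', c'} (insert {b, c} N))"
    "card (insert {b', c'} (insert {b, c} N)) = Suc (card (insert {b, c} N))"
    using good_insert[of "insert {b, c} N" b' c'] 1 assms by auto
  then show "good (insert {b', c'} (insert {b, c} N))"
    "card (insert {b', c'} (insert {b, c} N)) = card N + 2" using 1 by auto
qed

section \<open>Maximal choices and classes with three unpaired elements\<close>

definition maximal :: "'i set set \<Rightarrow> bool" where
  "maximal M \<longleftrightarrow> good M \<and> (\<forall>M'. good M' \<longrightarrow> card M' \<le> card M)"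

lemma maximal_exists: "\<exists>M. maximal M"
proof -
  have "good {}"
    unfolding good_def matching_def independent_family_def by (simp add: independent_empty)
  moreover have "card M \<le> card (Pow I)" if "good M" for M
    using that matching_subset_Pow finite_I unfolding good_def by (intro card_mono) auto
  ultimately have "\<exists>M. good M \<and> (\<forall>M'. good M' \<longrightarrow> card M' \<le> card M)"
    by (intro ex_has_greatest_nat[of good "{}" card "Suc (card (Pow I))"])
      (auto intro: le_imp_less_Suc)
  then show ?thesis unfolding maximal_def .
qed

definition left :: "'i set set \<Rightarrow> bool \<times> bool \<Rightarrow> 'i set" where
  "left M k = block k - \<Union>M"

text \<open>Two unpaired elements of a class differ by a vector of \<open>D M\<close>, as otherwise
  they could be added as a pair. If a paired \<open>h\<close> with partner \<open>h'\<close> lay in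
  another coset than these, replacing \<open>{h, h'}\<close> by \<open>{h, r}\<close> and
  \<open>{h', r'}\<close> for suitable unpaired \<open>r\<close>, \<open>r'\<close> would give a
  larger choice.\<close>

lemma maximal_many_left:
  assumes max: "maximal M" and three: "3 \<le> card (left M k)"
    and "i \<in> block k" "j \<in> block k"
  shows "x i + x j \<in> D M"
proof -
  have M: "good M" and le: "\<And>M'. good M' \<Longrightarrow> card M' \<le> card M"
    using max unfolding maximal_def by auto
  have mat: "matching M" using M good_def by blast
  have unc: "x r + x r' \<in> D M" if "r \<in> left M k" "r' \<in> left M k" for r r'
  proof (rule ccontr)
    assume neg: "x r + x r' \<notin> D M"
    then have "r \<noteq> r'" using span_zero by force
    then show False
      using good_insert[of M r r'] le[of "insert {r, r'} M"] M neg that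
      unfolding left_def block_def by auto
  qed
  obtain R where "R \<subseteq> left M k" "card R = 3"
    using three by (metis obtain_subset_with_card_n)
  then obtain r1 r2 r3 where r: "r1 \<in> left M k" "r2 \<in> left M k" "r3 \<in> left M k"
    "r1 \<noteq> r2" "r1 \<noteq> r3" "r2 \<noteq> r3"
    by (auto simp: card_3_iff)
  have base: "x h + x r1 \<in> D M" if h: "h \<in> block k" for h
  proof (cases "h \<in> \<Union>M")
    case False
    then show ?thesis using unc h r unfolding left_def by blast
  next
    case True
    then obtain p where p: "p \<in> M" "h \<in> p" by blast
    then obtain h' where h': "p = {h, h'}" "h' \<noteq> h" "h \<in> I" "h' \<in> I" "cls h' = cls h"
      using matchingE[OF mat] by metis
    define N where "N = M - {p}"
    have N: "good N" "N \<subseteq> M" "M = insert p N" "p \<notin> N"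
      using good_mono[OF M] p unfolding N_def by auto
    have sub: "D N \<subseteq> D M" using N by (intro span_mono) auto
    have pN: "x h + x h' \<notin> D N"
      using independent_family_notin_span[of "sum x" M p] M p h' unfolding good_def N_def by auto
    have split: "y \<in> D N \<or> y + (x h + x h') \<in> D N" if "y \<in> D M" for y
      using that h' unfolding N(3) by (simp add: span_insert_iff)
    \<comment> \<open>Pigeonhole: \<open>D N\<close> has index 2 in \<open>D M\<close>, so two of
      three vectors in one coset of \<open>D M\<close> agree modulo \<open>D N\<close>.\<close>
    have "\<exists>r\<in>left M k. \<exists>r'\<in>left M k. r \<noteq> r' \<and> x r + x r' \<in> D N"
    proof (rule ccontr)
      assume neg: "\<not> ?thesis"
      have "(x r1 + x r2) + (x h + x h') \<in> D N" "(x r1 + x r3) + (x h + x h') \<in> D N"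
        using split[OF unc[of r1 r2]] split[OF unc[of r1 r3]] neg r by blast+
      then have "((x r1 + x r2) + (x h + x h')) + ((x r1 + x r3) + (x h + x h')) \<in> D N"
        by (rule span_add)
      then have "x r2 + x r3 \<in> D N" by (simp add: ac_simps)
      then show False using neg r by blast
    qed
    then obtain r r' where rr: "r \<in> left M k" "r' \<in> left M k" "r \<noteq> r'" "x r + x r' \<in> D N"
      by blast
    show ?thesis
    proof (rule ccontr)
      assume neg: "x h + x r1 \<notin> D M"
      have hr: "x h + x r \<notin> D M"
      proof
        assume "x h + x r \<in> D M"
        from span_add[OF this unc[OF rr(1) r(1)]] neg show False by (simp add: ac_simps)
      qed
      have hh: "x h + x h' \<in> D M" using p h' by (intro span_base) force
      have h'r': "x h' + x r' \<notin> D M"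
      proof
        assume "x h' + x r' \<in> D M"
        from span_add[OF span_add[OF this hh] unc[OF rr(1,2)]] hr show False
          by (simp add: ac_simps)
      qed
      \<comment> \<open>The new pairs add up to \<open>x h + x h'\<close> plus
        \<open>x r + x r'\<close>. The second summand is in \<open>D N\<close> by the choice of
        \<open>r\<close>, \<open>r'\<close>, and the first is not.\<close>
      have four: "(x h + x r) + (x h' + x r') \<notin> D N"
      proof
        assume "(x h + x r) + (x h' + x r') \<in> D N"
        from span_add[OF this rr(4)] pN show False by (simp add: ac_simps)
      qed
      have disj: "q \<inter> p = {}" if "q \<in> N" for q
        using that p matching_disjoint[OF mat, of q p] unfolding N_def by auto
      have unc4: "{h, h', r, r'} \<inter> \<Union>N = {}"
        using disj h'(1) rr(1,2) N(2) unfolding left_def by blast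
      have "r \<notin> p" "r' \<notin> p" using rr(1,2) p(1) unfolding left_def by blast+
      then have dist: "distinct [h, h', r, r']" using h'(1,2) rr(3) by auto
      have in4: "{h, h', r, r'} \<subseteq> I" "cls h = cls r" "cls h' = cls r'"
        using h h' rr(1,2) unfolding left_def block_def by auto
      have "x h + x r \<notin> D N" "x h' + x r' \<notin> D N" using hr h'r' sub by blast+
      note new = good_insert_two[OF N(1) dist in4(1) unc4 in4(2,3) this four]
      have "card M = card N + 1"
        using N finite_good by simp
      then show False using le[OF new(1)] new(2) by simp
    qed
  qed
  from span_add[OF base[OF assms(3)] base[OF assms(4)]] show ?thesis
    by (simp add: ac_simps)
qed

section \<open>Re-pairing two pairs of the same class\<close>

definition exchange :: "'i \<Rightarrow> 'i \<Rightarrow> 'i \<Rightarrow> 'i \<Rightarrow> 'i set set \<Rightarrow> 'i set set" where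
  "exchange b b' c c' M = insert {b', c'} (insert {b, c} (M - {{b, b'}, {c, c'}}))"

definition exchangeable :: "'i \<Rightarrow> 'i \<Rightarrow> 'i \<Rightarrow> 'i \<Rightarrow> 'i set set \<Rightarrow> bool" where
  "exchangeable b b' c c' M \<longleftrightarrow> {b, b'} \<in> M \<and> {c, c'} \<in> M \<and> b \<noteq> b' \<and> c \<noteq> c' \<and>
     cls b = cls c \<and> x b + x c \<notin> D M"

lemma exchangeable_distinct:
  assumes M: "good M" and ex: "exchangeable b b' c c' M"
  shows "{b, b'} \<noteq> {c, c'}" "distinct [b, b', c, c']" "{b, b', c, c'} \<subseteq> I" "cls b' = cls c'"
proof -
  have mat: "matching M" using M good_def by blast
  have e: "{b, b'} \<in> M" "{c, c'} \<in> M" "b \<noteq> b'" "c \<noteq> c'" "cls b = cls c" "x b + x c \<notin> D M"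
    using ex exchangeable_def by auto
  show ne: "{b, b'} \<noteq> {c, c'}"
  proof
    assume eq: "{b, b'} = {c, c'}"
    have "x b + x b' \<in> D M" using pair_in_D e by simp
    moreover have "c = b \<or> c = b'" using eq by (auto simp: doubleton_eq_iff)
    ultimately show False using e(6) span_zero by auto
  qed
  then have "{b, b'} \<inter> {c, c'} = {}" using matching_disjoint[OF mat] e by metis
  then show "distinct [b, b', c, c']" using e by auto
  show "{b, b', c, c'} \<subseteq> I" using matching_subset_Pow[OF mat] e by blast
  have "cls b' = cls b" "cls c' = cls c"
    using matchingE[OF mat e(1), of b] matchingE[OF mat e(2), of c] e
    by (metis doubleton_eq_iff insertI1)+
  then show "cls b' = cls c'" using e by simp
qed

text \<open>Both new sums lie outside \<open>D M\<close>, and together they equal the sum of the two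
  old pairs, which is not in the span of the remaining pairs. The last claim bounds the growth of
  the span by one generator: \<open>x b' + x c'\<close> comes from \<open>x b + x c\<close> and the
  old pair sums.\<close>

lemma exchange_good:
  assumes M: "good M" and ex: "exchangeable b b' c c' M"
  shows "good (exchange b b' c c' M)" "card (exchange b b' c c' M) = card M"
    "\<Union>(exchange b b' c c' M) = \<Union>M"
    "D (exchange b b' c c' M) \<subseteq> span (insert (x b + x c) (sum x ` M))"
proof -
  have mat: "matching M" using M good_def by blast
  have e: "{b, b'} \<in> M" "{c, c'} \<in> M" "b \<noteq> b'" "c \<noteq> c'" "cls b = cls c" "x b + x c \<notin> D M"
    using ex exchangeable_def by auto
  note d = exchangeable_distinct[OF M ex]
  define N where "N = M - {{b, b'}, {c, c'}}"
  have N: "good N" "M = insert {b, b'} (insert {c, c'} N)" "{b, b'} \<notin> N" "{c, c'} \<notin> N"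
    using good_mono[OF M] e unfolding N_def by auto
  have sub: "D N \<subseteq> D M" using N by (intro span_mono) auto
  have pq: "x b + x b' \<in> D M" "x c + x c' \<in> D M"
    using pair_in_D e by simp_all
  have D2: "x b' + x c' \<notin> D M"
  proof
    assume "x b' + x c' \<in> D M"
    from span_add[OF span_add[OF this pq(1)] pq(2)] e(6) show False by (simp add: ac_simps)
  qed
  have D3: "(x b + x c) + (x b' + x c') \<notin> D N"
  proof
    assume "(x b + x c) + (x b' + x c') \<in> D N"
    then have "(x b + x b') + (x c + x c') \<in> D N" by (simp add: ac_simps)
    then have "x b + x b' \<in> D (insert {c, c'} N)"
      using e by (simp add: span_insert_iff)
    moreover have "insert P (insert Q N) - {P} = insert Q N" if "P \<notin> N" "P \<noteq> Q" for P Q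
      using that by auto
    from this[OF N(3) d(1)] have "M - {{b, b'}} = insert {c, c'} N"
      unfolding N(2)[symmetric] .
    ultimately have "sum x {b, b'} \<in> D (M - {{b, b'}})" using e(3) by simp
    then show False
      using independent_family_notin_span[OF _ e(1), of "sum x"] M unfolding good_def by simp
  qed
  have unc: "{b, b', c, c'} \<inter> \<Union>N = {}"
  proof -
    have "q \<inter> {b, b'} = {}" "q \<inter> {c, c'} = {}" if "q \<in> N" for q
      using that matching_disjoint[OF mat, of q "{b, b'}"] matching_disjoint[OF mat, of q "{c, c'}"] e
      unfolding N_def by auto
    then show ?thesis by blast
  qed
  have D1': "x b + x c \<notin> D N" and D2': "x b' + x c' \<notin> D N"
    using e(6) D2 subsetD[OF sub] by auto
  have g: "good (exchange b b' c c' M)" "card (exchange b b' c c' M) = card N + 2"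
    unfolding exchange_def N_def[symmetric]
    using good_insert_two[OF N(1) d(2,3) unc e(5) d(4) D1' D2' D3] by simp_all
  show "good (exchange b b' c c' M)" by (rule g)
  show "card (exchange b b' c c' M) = card M"
    using g(2) N d(1) finite_good[OF N(1)] by simp
  show "\<Union>(exchange b b' c c' M) = \<Union>M"
    unfolding exchange_def N_def[symmetric] using N(2) by auto
  have "x b' + x c' = (x b + x c) + ((x b + x b') + (x c + x c'))" by (simp add: ac_simps)
  moreover have "D M \<subseteq> span (insert (x b + x c) (sum x ` M))" by (intro span_mono) auto
  moreover have "x b + x c \<in> span (insert (x b + x c) (sum x ` M))" by (simp add: span_base)
  ultimately have "x b' + x c' \<in> span (insert (x b + x c) (sum x ` M))"
    using pq by (simp only: span_add subsetD)
  moreover have "sum x ` N \<subseteq> span (insert (x b + x c) (sum x ` M))"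
    using N by (auto intro: span_base)
  ultimately show "D (exchange b b' c c' M) \<subseteq> span (insert (x b + x c) (sum x ` M))"
    unfolding exchange_def N_def[symmetric]
    using d(2) by (intro span_minimal subspace_span) (auto intro: span_base)
qed

text \<open>The old and the new span intersect in the span of the untouched pairs and of the sum of
  the two re-paired ones. As coordinates with respect to \<open>M\<close> are unique, a vector of
  the intersection uses both old pairs or neither.\<close>

lemma exchange_same_coordinates:
  assumes M: "good M" and ex: "exchangeable b b' c c' M"
    and T: "T \<subseteq> M" and y: "sum (sum x) T \<in> D (exchange b b' c c' M)"
  shows "{b, b'} \<in> T \<longleftrightarrow> {c, c'} \<in> T"
proof -
  have e: "{b, b'} \<in> M" "{c, c'} \<in> M" "b \<noteq> b'" "c \<noteq> c'" "cls b = cls c" "x b + x c \<notin> D M"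
    using ex exchangeable_def by auto
  note d = exchangeable_distinct[OF M ex]
  define N where "N = M - {{b, b'}, {c, c'}}"
  define y where "y = sum (sum x) T"
  have fin: "finite M" "finite N" using finite_good[OF M] N_def by auto
  have sub: "D N \<subseteq> D M" unfolding N_def by (intro span_mono) auto
  have pq: "x b + x b' \<in> D M" "x c + x c' \<in> D M"
    using pair_in_D e by simp_all
  have yM: "y \<in> D M"
    unfolding y_def using T by (intro span_sum span_base imageI) blast
  have uniq: "T = S" if "S \<subseteq> M" "sum (sum x) S = y" for S
    using independent_family_subset_sum_inj[of "sum x" M] M fin T that
    unfolding good_def y_def by (metis subset_antisym)
  \<comment> \<open>Since \<open>y\<close> is in \<open>D M\<close>, a representation of it with
    exactly one of the new pairs would put \<open>x b + x c\<close> into \<open>D M\<close>.\<close>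
  have not1: "y + (x b + x c) \<notin> D N"
  proof
    assume "y + (x b + x c) \<in> D N"
    then have "y + (x b + x c) \<in> D M" using sub by blast
    from span_add[OF this yM] e(6) show False by (simp add: ac_simps)
  qed
  have not2: "y + (x b' + x c') \<notin> D N"
  proof
    assume "y + (x b' + x c') \<in> D N"
    then have "y + (x b' + x c') \<in> D M" using sub by blast
    from span_add[OF span_add[OF this yM] span_add[OF pq]] e(6) show False
      by (simp add: ac_simps)
  qed
  have "y \<in> D N \<or> y + ((x b + x b') + (x c + x c')) \<in> D N"
    using y not1 not2 d(2) unfolding exchange_def y_def[symmetric] N_def[symmetric]
    by (auto simp: span_insert_iff ac_simps)
  then consider S where "S \<subseteq> N" "y = sum (sum x) S"
    | S where "S \<subseteq> N" "y + ((x b + x b') + (x c + x c')) = sum (sum x) S"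
    using span_image_subset_sums[OF fin(2), of "sum x"] by auto
  then show ?thesis
  proof cases
    case 1
    then have "T = S" using uniq N_def by blast
    then show ?thesis using 1 N_def by blast
  next
    case 2
    have "finite S" "{b, b'} \<notin> S" "{c, c'} \<notin> S"
      using 2 fin finite_subset N_def by auto
    then have "sum (sum x) (insert {b, b'} (insert {c, c'} S))
        = (x b + x b') + ((x c + x c') + sum (sum x) S)"
      using d(1) e by simp
    also have "\<dots> = y" unfolding 2(2)[symmetric] by (simp add: ac_simps)
    finally have "T = insert {b, b'} (insert {c, c'} S)"
      using 2(1) e(1,2) unfolding N_def by (intro uniq) auto
    then show ?thesis by simp
  qed
qed

section \<open>Counting paired and unpaired elements by class\<close>

definition pairs :: "'i set set \<Rightarrow> bool \<times> bool \<Rightarrow> 'i set set" where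
  "pairs M k = {p \<in> M. p \<subseteq> block k}"

lemma in_pairs:
  assumes "matching M" "p \<in> M" "i \<in> p"
  shows "p \<in> pairs M (cls i)"
proof (rule matchingE[OF assms])
  fix j assume "p = {i, j}" "i \<in> I" "j \<in> I" "cls j = cls i"
  then show ?thesis using assms(2) unfolding pairs_def block_def by simp
qed

lemma pairs_disjoint:
  assumes "matching M" "k \<noteq> k'"
  shows "pairs M k \<inter> pairs M k' = {}"
proof (rule equals0I)
  fix p assume p: "p \<in> pairs M k \<inter> pairs M k'"
  then obtain i where "i \<in> p" using matching_nonempty[OF assms(1)] unfolding pairs_def by blast
  then show False using p assms(2) unfolding pairs_def block_def by blast
qed

lemma matching_eq_Union_pairs:
  assumes "matching M"
  shows "M = (\<Union>k. pairs M k)"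
proof (intro equalityI subsetI)
  fix p assume p: "p \<in> M"
  then obtain i where "i \<in> p" using matching_nonempty[OF assms] by blast
  then show "p \<in> (\<Union>k. pairs M k)" using in_pairs[OF assms p] by blast
qed (auto simp: pairs_def)

lemma finite_pairs: "matching M \<Longrightarrow> finite (pairs M k)"
  using finite_matching unfolding pairs_def by simp

lemma card_matching:
  assumes "matching M"
  shows "card M = (\<Sum>k\<in>UNIV. card (pairs M k))"
proof -
  have "card (\<Union>k\<in>UNIV. pairs M k) = (\<Sum>k\<in>UNIV. card (pairs M k))"
    using finite_pairs[OF assms] pairs_disjoint[OF assms] by (intro card_UN_disjoint) auto
  then show ?thesis using matching_eq_Union_pairs[OF assms] by simp
qed

lemma finite_block: "finite (block k)"
  using finite_I unfolding block_def by simp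

lemma card_block:
  assumes "matching M"
  shows "card (block k) = 2 * card (pairs M k) + card (left M k)"
proof -
  have eq: "block k \<inter> \<Union>M = \<Union>(pairs M k)"
  proof (intro equalityI subsetI)
    fix i assume "i \<in> block k \<inter> \<Union>M"
    then obtain p where p: "p \<in> M" "i \<in> p" "cls i = k" unfolding block_def by blast
    then show "i \<in> \<Union>(pairs M k)" using in_pairs[OF assms p(1,2)] by blast
  qed (auto simp: pairs_def)
  have two: "card p = 2" if "p \<in> pairs M k" for p
  proof -
    from that have "p \<in> M" unfolding pairs_def by simp
    from matching_pair[OF assms this] show ?thesis by fastforce
  qed
  have "card (\<Union>(pairs M k)) = sum card (pairs M k)"
  proof (rule card_Union_disjoint)
    show "pairwise disjnt (pairs M k)"
      using matching_disjoint[OF assms] unfolding pairwise_def disjnt_def pairs_def by simp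
    show "finite p" if "p \<in> pairs M k" for p
      using two[OF that] card.infinite by fastforce
  qed
  also have "\<dots> = 2 * card (pairs M k)" using two by simp
  finally have "card (block k \<inter> \<Union>M) = 2 * card (pairs M k)" using eq by simp
  moreover have "card (block k) = card (block k \<inter> \<Union>M) + card (block k - \<Union>M)"
    using card_Int_Diff[OF finite_block] .
  ultimately show ?thesis unfolding left_def by simp
qed

section \<open>Classes contained in a single coset\<close>

text \<open>
  A class with at most two unpaired elements need not be contained in a coset of \<open>D M\<close>; the
  exchange argument only sees its paired elements.
\<close>

definition core :: "'i set set \<Rightarrow> bool \<times> bool \<Rightarrow> 'i set" where
  "core M k = (if 3 \<le> card (left M k) then block k else block k - left M k)"

text \<open>As subtraction is addition, this places the core in one coset of \<open>D M\<close>; an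
  empty core counts as flat.\<close>

definition flat :: "'i set set \<Rightarrow> bool \<times> bool \<Rightarrow> bool" where
  "flat M k \<longleftrightarrow> (\<forall>i\<in>core M k. \<forall>j\<in>core M k. x i + x j \<in> D M)"

lemma core_subset: "core M k \<subseteq> block k"
  unfolding core_def by auto

lemma core_cong: "\<Union>M' = \<Union>M \<Longrightarrow> core M' k = core M k"
  unfolding core_def left_def by simp

lemma maximal_flat: "maximal M \<Longrightarrow> 3 \<le> card (left M k) \<Longrightarrow> flat M k"
  unfolding flat_def using core_subset[of M k] by (intro ballI maximal_many_left) auto

lemma independent_core: "independent_family x (core M k)"
  using core_subset[of M k]
  by (intro independent_family_mono[OF independent_side[of "fst k"]]) (auto simp: block_def)

text \<open>The 3 counts one representative of the coset and at most two unpaired elements outside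
  the core.\<close>

lemma flat_span:
  assumes "flat M k" "D M \<subseteq> span Z"
  shows "\<exists>X. finite X \<and> card X \<le> 3 \<and> x ` block k \<subseteq> span (Z \<union> X)"
proof -
  define R where "R = block k - core M k"
  have R: "finite R" "card R \<le> 2"
  proof -
    show "finite R" unfolding R_def using finite_block by simp
    have "block k - (block k - left M k) = left M k" unfolding left_def by blast
    then show "card R \<le> 2" unfolding R_def core_def by auto
  qed
  show ?thesis
  proof (cases "core M k = {}")
    case True
    then have "x ` block k \<subseteq> span (Z \<union> x ` R)"
      unfolding R_def by (auto intro: span_base)
    moreover have "card (x ` R) \<le> 3" using R card_image_le[of R x] by linarith
    ultimately show ?thesis using R by blast
  next
    case False
    then obtain i where i: "i \<in> core M k" by blast
    define X where "X = insert (x i) (x ` R)"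
    have "card X \<le> 3"
      using R card_image_le[of R x] card_insert_le_m1[of 3 "x ` R" "x i"] unfolding X_def by simp
    moreover have "x j \<in> span (Z \<union> X)" if "j \<in> block k" for j
    proof (cases "j \<in> core M k")
      case True
      then have "x j + x i \<in> span Z" using assms i unfolding flat_def by blast
      then have "x j + x i \<in> span (Z \<union> X)" using span_mono[of Z "Z \<union> X"] by blast
      moreover have "x i \<in> span (Z \<union> X)" unfolding X_def by (simp add: span_base)
      ultimately have "(x j + x i) + x i \<in> span (Z \<union> X)" by (rule span_add)
      then show ?thesis by (simp add: add.assoc)
    next
      case False
      then show ?thesis using that unfolding X_def R_def by (auto intro: span_base)
    qed
    moreover have "finite X" unfolding X_def using R(1) by simp
    ultimately show ?thesis by (intro exI[of _ X] conjI image_subsetI)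
  qed
qed

text \<open>The two classes make up one side of \<open>n\<close> independent vectors, and each costs
  at most three generators beyond \<open>Z\<close>. Separate choices \<open>M\<close> and
  \<open>M'\<close> allow one class to be flat before and the other after an exchange.\<close>

lemma two_flat:
  assumes "flat M (s, u)" "flat M' (s, \<not> u)" "D M \<subseteq> span Z" "D M' \<subseteq> span Z" "finite Z"
  shows "n \<le> card Z + 6"
proof -
  obtain X where X: "finite X" "card X \<le> 3" "x ` block (s, u) \<subseteq> span (Z \<union> X)"
    using flat_span[OF assms(1,3)] by blast
  obtain Y where Y: "finite Y" "card Y \<le> 3" "x ` block (s, \<not> u) \<subseteq> span (Z \<union> Y)"
    using flat_span[OF assms(2,4)] by blast
  have "{i \<in> I. fst (cls i) = s} = block (s, u) \<union> block (s, \<not> u)"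
    unfolding block_def by (auto simp: prod_eq_iff)
  moreover have "span (Z \<union> X) \<subseteq> span (Z \<union> X \<union> Y)" "span (Z \<union> Y) \<subseteq> span (Z \<union> X \<union> Y)"
    by (intro span_mono; blast)+
  ultimately have "x ` {i \<in> I. fst (cls i) = s} \<subseteq> span (Z \<union> X \<union> Y)"
    using X(3) Y(3) by (auto simp: image_Un)
  then have "n \<le> card (Z \<union> X \<union> Y)"
    using independent_family_card_le[OF independent_side[of s]] assms(5) X(1) Y(1)
    by (simp add: card_side)
  also have "\<dots> \<le> card Z + card X + card Y"
    using card_Un_le[of "Z \<union> X" Y] card_Un_le[of Z X] by linarith
  finally show ?thesis using X(2) Y(2) by linarith
qed

text \<open>Two pairs with elements in different cosets of \<open>D M\<close> can be re-paired, and
  the vector survives this only if it uses both or neither. In a class that is not flat, this links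
  all pairs. With fewer than three unpaired elements the core consists of paired elements
  only.\<close>

lemma coordinates_constant:
  assumes M: "good M" and "\<not> flat M k" "card (left M k) < 3" and T: "T \<subseteq> M"
    and stable: "\<And>b b' c c'. exchangeable b b' c c' M \<Longrightarrow> cls b = k \<Longrightarrow>
      sum (sum x) T \<in> D (exchange b b' c c' M)"
  shows "pairs M k \<subseteq> T \<or> pairs M k \<inter> T = {}"
proof -
  have mat: "matching M" using M good_def by blast
  have agree: "p \<in> T \<longleftrightarrow> q \<in> T"
    if pq: "p \<in> pairs M k" "q \<in> pairs M k" "b \<in> p" "c \<in> q" "x b + x c \<notin> D M" for p q b c
  proof -
    have M': "p \<in> M" "q \<in> M" and cls: "cls b = k" "cls c = k"
      using pq unfolding pairs_def block_def by auto
    obtain b' where b': "p = {b, b'}" "b' \<noteq> b" using matchingE[OF mat M'(1) pq(3)] by metis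
    obtain c' where c': "q = {c, c'}" "c' \<noteq> c" using matchingE[OF mat M'(2) pq(4)] by metis
    have ex: "exchangeable b b' c c' M"
      unfolding exchangeable_def using M' cls b' c' pq(5) by auto
    show ?thesis
      using exchange_same_coordinates[OF M ex T stable[OF ex cls(1)]] b' c' by simp
  qed
  obtain i j where ij: "i \<in> core M k" "j \<in> core M k" "x i + x j \<notin> D M"
    using assms(2) unfolding flat_def by blast
  then obtain P Q where P: "P \<in> M" "i \<in> P" "cls i = k" and Q: "Q \<in> M" "j \<in> Q" "cls j = k"
    using assms(3) unfolding core_def left_def block_def by auto
  have PQ: "P \<in> pairs M k" "Q \<in> pairs M k"
    using in_pairs[OF mat P(1,2)] in_pairs[OF mat Q(1,2)] P(3) Q(3) by simp_all
  have "p \<in> T \<longleftrightarrow> P \<in> T" if p: "p \<in> pairs M k" for p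
  proof -
    have "p \<in> M" using p unfolding pairs_def by simp
    then obtain b where b: "b \<in> p" using matching_nonempty[OF mat] by blast
    \<comment> \<open>As \<open>i\<close> and \<open>j\<close> lie in different cosets,
      \<open>b\<close> is in another coset than one of them. This links \<open>p\<close> to
      \<open>P\<close> directly or through \<open>Q\<close>.\<close>
    have "x b + x i \<notin> D M \<or> x b + x j \<notin> D M"
    proof (rule ccontr)
      assume "\<not> ?thesis"
      then have "(x b + x i) + (x b + x j) \<in> D M" using span_add by simp
      then show False using ij(3) by (simp add: ac_simps)
    qed
    then show ?thesis
      using agree[OF p PQ(1) b P(2)] agree[OF p PQ(2) b Q(2)] agree[OF PQ P(2) Q(2) ij(3)]
      by auto
  qed
  then show ?thesis by auto
qed

text \<open>
  A vector that stays in the span under all exchanges has constant coordinates on each class that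
  is not flat, so such a class contributes a single dimension.
\<close>

lemma stable_span:
  assumes M: "good M" and small: "\<And>k. \<not> flat M k \<Longrightarrow> card (left M k) < 3"
    and y: "y \<in> D M"
    and stable: "\<And>b b' c c'. exchangeable b b' c c' M \<Longrightarrow> \<not> flat M (cls b) \<Longrightarrow>
      y \<in> D (exchange b b' c c' M)"
  shows "y \<in> span (sum x ` (\<Union>k\<in>{k. flat M k}. pairs M k) \<union>
      (\<lambda>k. sum (sum x) (pairs M k)) ` {k. \<not> flat M k})" (is "y \<in> span ?S")
proof -
  have mat: "matching M" using M good_def by blast
  obtain T where T: "T \<subseteq> M" "y = sum (sum x) T"
    using y span_image_subset_sums[OF finite_good[OF M], of "sum x"] by auto
  have fin: "finite T" using T finite_good[OF M] finite_subset by blast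
  have "T \<subseteq> (\<Union>k. pairs M k)"
    using T(1) unfolding matching_eq_Union_pairs[OF mat, symmetric] .
  then have "T = T \<inter> (\<Union>k. pairs M k)" by (rule Int_absorb2[symmetric])
  also have "\<dots> = (\<Union>k. T \<inter> pairs M k)" by (rule Int_UN_distrib)
  finally have "y = sum (sum x) (\<Union>k\<in>UNIV. T \<inter> pairs M k)" using T(2) by (rule back_subst[rotated])
  also have "\<dots> = (\<Sum>k\<in>UNIV. sum (sum x) (T \<inter> pairs M k))"
  proof (intro sum.UNION_disjoint ballI impI)
    fix k k' :: "bool \<times> bool" assume "k \<noteq> k'"
    from pairs_disjoint[OF mat this] show "T \<inter> pairs M k \<inter> (T \<inter> pairs M k') = {}" by blast
  qed (simp_all add: fin)
  also have "\<dots> \<in> span ?S"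
  proof (rule span_sum)
    fix k :: "bool \<times> bool"
    show "sum (sum x) (T \<inter> pairs M k) \<in> span ?S"
    proof (cases "flat M k")
      case True
      then show ?thesis by (intro span_sum span_base) auto
    next
      case False
      have "pairs M k \<subseteq> T \<or> pairs M k \<inter> T = {}"
        using coordinates_constant[OF M False small[OF False] T(1)] stable False T(2) by blast
      then have "T \<inter> pairs M k = pairs M k \<or> T \<inter> pairs M k = {}" by blast
      moreover have "sum (sum x) (pairs M k) \<in> span ?S"
        using False by (intro span_base) auto
      ultimately show ?thesis using span_zero by auto
    qed
  qed
  finally show ?thesis .
qed

text \<open>If the class stays flat, the differences of its core elements survive all these
  exchanges. So the core, which is independent, lies in the span of one representative, the pair
  sums of the flat classes and one vector for each other class.\<close>

lemma core_bound:
  assumes M: "good M" and small: "\<And>k. \<not> flat M k \<Longrightarrow> card (left M k) < 3"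
    and k: "flat M k"
    and stable: "\<And>b b' c c'. exchangeable b b' c c' M \<Longrightarrow> \<not> flat M (cls b) \<Longrightarrow>
      flat (exchange b b' c c' M) k"
  shows "card (core M k) \<le> 1 + (\<Sum>k | flat M k. card (pairs M k)) + card {k. \<not> flat M k}"
proof (cases "core M k = {}")
  case True
  then show ?thesis by simp
next
  case False
  then obtain i where i: "i \<in> core M k" by blast
  have mat: "matching M" using M good_def by blast
  let ?F = "sum x ` (\<Union>k\<in>{k. flat M k}. pairs M k)"
  let ?G = "(\<lambda>k. sum (sum x) (pairs M k)) ` {k. \<not> flat M k}"
  have "x j \<in> span (insert (x i) (?F \<union> ?G))" if j: "j \<in> core M k" for j
  proof -
    have "x j + x i \<in> span (?F \<union> ?G)"
    proof (rule stable_span[OF M small])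
      show "x j + x i \<in> D M" using k i j unfolding flat_def by blast
      fix b b' c c' assume ex: "exchangeable b b' c c' M" "\<not> flat M (cls b)"
      have "core (exchange b b' c c' M) k = core M k"
        using exchange_good(3)[OF M ex(1)] by (rule core_cong)
      then show "x j + x i \<in> D (exchange b b' c c' M)"
        using stable[OF ex] i j unfolding flat_def by simp
    qed
    then show ?thesis by (simp add: span_insert_iff)
  qed
  then have "card (core M k) \<le> card (insert (x i) (?F \<union> ?G))"
    using finite_pairs[OF mat]
    by (intro independent_family_card_le[OF independent_core] image_subsetI) simp_all
  moreover have "card (insert (x i) (?F \<union> ?G)) \<le> Suc (card (?F \<union> ?G))"
    by (rule card_insert_le_m1) simp_all
  moreover have "card (?F \<union> ?G) \<le> card ?F + card ?G" by (rule card_Un_le)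
  moreover have "card ?G \<le> card {k. \<not> flat M k}" by (rule card_image_le) simp
  moreover have "card ?F \<le> card (\<Union>k\<in>{k. flat M k}. pairs M k)"
    using finite_pairs[OF mat] by (intro card_image_le) simp
  moreover have "card (\<Union>k\<in>{k. flat M k}. pairs M k) \<le> (\<Sum>k | flat M k. card (pairs M k))"
    by (rule card_UN_le) simp
  ultimately show ?thesis by linarith
qed

section \<open>Dimension count for maximal choices\<close>

lemma maximal_exchange:
  assumes "maximal M" "exchangeable b b' c c' M"
  shows "maximal (exchange b b' c c' M)"
  using assms exchange_good(1,2)[of M b b' c c'] unfolding maximal_def by simp

lemma maximal_small_left: "maximal M \<Longrightarrow> \<not> flat M k \<Longrightarrow> card (left M k) < 3"
  using maximal_flat[of M k] by linarith

lemma card_core: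
  assumes "matching M"
  shows "card (core M k) = 2 * card (pairs M k) + (if 3 \<le> card (left M k) then card (left M k) else 0)"
proof -
  have "left M k \<subseteq> block k" unfolding left_def by blast
  then have "card (block k - left M k) = card (block k) - card (left M k)"
    using finite_subset[OF _ finite_block] by (intro card_Diff_subset) simp_all
  then show ?thesis using card_block[OF assms, of k] unfolding core_def by simp
qed

lemma bool_pair_cases: "k \<in> {(s, u), (s, \<not> u), (\<not> s, w), (\<not> s, \<not> w)}"
  for k :: "bool \<times> bool"
  by (cases k) auto

lemma sum_bool_pair: "sum f UNIV = f (s, u) + f (s, \<not> u) + f (\<not> s, w) + f (\<not> s, \<not> w)"
  for f :: "bool \<times> bool \<Rightarrow> nat"
proof -
  have UNIV_eq: "UNIV = {(s, u), (s, \<not> u), (\<not> s, w), (\<not> s, \<not> w)}"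
    using bool_pair_cases by blast
  show ?thesis unfolding UNIV_eq by simp
qed

lemma card_side_blocks: "n = card (block (s, True)) + card (block (s, False))"
proof -
  have "{i \<in> I. fst (cls i) = s} = block (s, True) \<union> block (s, False)"
    unfolding block_def by (auto simp: prod_eq_iff)
  moreover have "block (s, True) \<inter> block (s, False) = {}"
    unfolding block_def by auto
  ultimately show ?thesis
    using card_side[of s] card_Un_disjoint[OF finite_block finite_block] by simp
qed

lemma sum_left:
  assumes "matching M"
  shows "2 * n = 2 * card M + (\<Sum>k\<in>UNIV. card (left M k))"
proof -
  have "2 * n = (\<Sum>k\<in>UNIV. card (block k))"
    using card_side_blocks[of True] card_side_blocks[of False] sum_bool_pair[of "\<lambda>k. card (block k)" True True True]
    by simp
  also have "\<dots> = 2 * card M + (\<Sum>k\<in>UNIV. card (left M k))"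
    unfolding card_block[OF assms] card_matching[OF assms] by (simp add: sum.distrib sum_distrib_left)
  finally show ?thesis .
qed

text \<open>Passing to \<open>M'\<close> adds at most one generator \<open>e\<close>, so two flat
  classes on one side would give \<open>n \<le> (card M + 1) + 6\<close>.\<close>

lemma maximal_not_both_flat:
  assumes "maximal M" "card M + 8 \<le> n" "flat M (s, u)" "flat M' (s, \<not> u)"
    and M': "M' = M \<or> (\<exists>b b' c c'. exchangeable b b' c c' M \<and> M' = exchange b b' c c' M)"
  shows False
proof -
  have M: "good M" using assms(1) maximal_def by blast
  obtain e where e: "D M' \<subseteq> span (insert e (sum x ` M))"
  proof (cases "M' = M")
    case True
    show ?thesis
      by (rule that[of 0]) (use True span_mono[OF subset_insertI] in simp)
  next
    case False
    then obtain b b' c c' where "exchangeable b b' c c' M" "M' = exchange b b' c c' M"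
      using M' by blast
    then show ?thesis using exchange_good(4)[OF M] by (intro that[of "x b + x c"]) simp
  qed
  have fin: "finite (sum x ` M)" using finite_good[OF M] by simp
  have "D M \<subseteq> span (insert e (sum x ` M))" by (intro span_mono) auto
  from two_flat[OF assms(3,4) this e] fin have "n \<le> card (insert e (sum x ` M)) + 6" by simp
  moreover have "card (insert e (sum x ` M)) \<le> Suc (card (sum x ` M))"
    by (rule card_insert_le_m1) simp_all
  moreover have "card (sum x ` M) \<le> card M"
    using finite_good[OF M] by (rule card_image_le)
  ultimately show False using assms(2) by linarith
qed

text \<open>If side \<open>s\<close> has no flat class, each of its classes has at most two unpaired
  elements, so a class on the other side has three and is the only flat one. By
  \<open>core_bound\<close> with three other classes it has at most 4 unpaired elements. But at
  least 16 elements are unpaired, at most 6 of them in the other classes.\<close>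

lemma maximal_flat_on_each_side:
  assumes max: "maximal M" and less: "card M + 8 \<le> n"
  shows "\<exists>u. flat M (s, u)"
proof (rule ccontr)
  assume "\<nexists>u. flat M (s, u)"
  then have s: "\<not> flat M (s, u)" for u by blast
  have M: "good M" "matching M" using max maximal_def good_def by auto
  note small = maximal_small_left[OF max]
  have "16 \<le> (\<Sum>k\<in>UNIV. card (left M k))"
    using sum_left[OF M(2)] less by linarith
  moreover have "card (left M (s, True)) < 3" "card (left M (s, False)) < 3"
    using small s by auto
  ultimately have "3 \<le> card (left M (\<not> s, True)) \<or> 3 \<le> card (left M (\<not> s, False))"
    using sum_bool_pair[of "\<lambda>k. card (left M k)" s True True] by simp linarith
  then obtain u where u: "3 \<le> card (left M (\<not> s, u))" by blast
  then have flat: "flat M (\<not> s, u)" using maximal_flat[OF max] by simp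
  have nflat: "\<not> flat M (\<not> s, \<not> u)"
    using maximal_not_both_flat[OF max less flat] by blast
  have iff: "flat M k \<longleftrightarrow> k = (\<not> s, u)" for k
    using bool_pair_cases[of k s True u] s flat nflat by auto
  have F: "{k. flat M k} = {(\<not> s, u)}" and nF: "{k. \<not> flat M k} = {(s, True), (s, False), (\<not> s, \<not> u)}"
    using bool_pair_cases[of _ s True u] by (auto simp: iff)
  have "card (core M (\<not> s, u)) \<le> 1 + (\<Sum>k | flat M k. card (pairs M k)) + card {k. \<not> flat M k}"
  proof (rule core_bound[OF M(1) small flat])
    fix b b' c c' assume ex: "exchangeable b b' c c' M"
    \<comment> \<open>An exchange keeps the unpaired elements and maximality, so three unpaired
      elements force flatness again.\<close>
    have "left (exchange b b' c c' M) (\<not> s, u) = left M (\<not> s, u)"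
      unfolding left_def exchange_good(3)[OF M(1) ex] ..
    then show "flat (exchange b b' c c' M) (\<not> s, u)"
      using maximal_flat[OF maximal_exchange[OF max ex]] u by simp
  qed
  then have "card (core M (\<not> s, u)) \<le> 4 + card (pairs M (\<not> s, u))"
    unfolding F nF by simp
  moreover have "card (left M (\<not> s, \<not> u)) < 3" using small nflat by simp
  ultimately show False
    using card_core[OF M(2), of "(\<not> s, u)"] u sum_left[OF M(2)] less small[OF s[of True]] small[OF s[of False]]
      sum_bool_pair[of "\<lambda>k. card (left M k)" s True u] by simp
qed

text \<open>Otherwise each side has exactly one flat class. An exchange cannot pass flatness on to
  the other class of that side, since the span grows by one generator only. Hence
  \<open>core_bound\<close> applies to both flat classes.\<close>

lemma large_independent_matching:
  assumes max: "maximal M"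
  shows "n \<le> card M + 7"
proof (rule ccontr)
  assume "\<not> ?thesis"
  then have less: "card M + 8 \<le> n" by simp
  have M: "good M" "matching M" using max maximal_def good_def by auto
  note small = maximal_small_left[OF max]
  have stable: "flat (exchange b b' c c' M) (s, u)"
    if ex: "exchangeable b b' c c' M" and flat: "flat M (s, u)" for b b' c c' s u
  proof (rule ccontr)
    assume "\<not> ?thesis"
    moreover have "card (exchange b b' c c' M) + 8 \<le> n"
      using exchange_good(2)[OF M(1) ex] less by simp
    then obtain v where v: "flat (exchange b b' c c' M) (s, v)"
      using maximal_flat_on_each_side[OF maximal_exchange[OF max ex]] by blast
    ultimately have "v = (\<not> u)" by (cases u; cases v) auto
    then show False
      using maximal_not_both_flat[OF max less flat] v ex by blast
  qed
  obtain u w where u: "flat M (True, u)" and w: "flat M (False, w)"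
    using maximal_flat_on_each_side[OF max less] by blast
  have nu: "\<not> flat M (True, \<not> u)" and nw: "\<not> flat M (False, \<not> w)"
    using maximal_not_both_flat[OF max less u] maximal_not_both_flat[OF max less w] by blast+
  have iff: "flat M k \<longleftrightarrow> k = (True, u) \<or> k = (False, w)" for k
    using bool_pair_cases[of k True u w] u w nu nw by auto
  have F: "{k. flat M k} = {(True, u), (False, w)}"
    and nF: "{k. \<not> flat M k} = {(True, \<not> u), (False, \<not> w)}"
    using bool_pair_cases[of _ True u w] by (auto simp: iff)
  have "card (core M (s, v)) \<le> 3 + card (pairs M (True, u)) + card (pairs M (False, w))"
    if "flat M (s, v)" for s v
    using core_bound[OF M(1) small that stable[OF _ that]] unfolding F nF by simp
  \<comment> \<open>Adding both bounds cancels the pair counts: flat classes with at least three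
    unpaired elements have at most 6 of them altogether. All other classes have at most two each, so
    fewer than 16 elements are unpaired.\<close>
  from this[OF u] this[OF w]
  show False
    using card_core[OF M(2), of "(True, u)"] card_core[OF M(2), of "(False, w)"] less
      small[OF nu] small[OF nw] sum_left[OF M(2)]
      sum_bool_pair[of "\<lambda>k. card (left M k)" True u w]
    by (cases "3 \<le> card (left M (True, u))"; cases "3 \<le> card (left M (False, w))") simp_all
qed

text \<open>One side holds at most \<open>n/2\<close> of the at least \<open>n - 7\<close> pairs,
  which leaves at least \<open>n/2 - 7\<close> for the other.\<close>

theorem balanced_independent_matching:
  "\<exists>M. good M \<and> (\<forall>s. n \<le> 2 * card {p \<in> M. \<forall>i\<in>p. fst (cls i) = s} + 14)"
proof -
  obtain M where max: "maximal M" using maximal_exists by blast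
  have M: "good M" "matching M" using max maximal_def good_def by auto
  have "n \<le> 2 * card {p \<in> M. \<forall>i\<in>p. fst (cls i) = s} + 14" for s
  proof -
    have "card (pairs M (s, True) \<union> pairs M (s, False)) \<le> card {p \<in> M. \<forall>i\<in>p. fst (cls i) = s}"
      using finite_matching[OF M(2)] by (intro card_mono) (auto simp: pairs_def block_def)
    moreover have "card (pairs M (s, True) \<union> pairs M (s, False))
        = card (pairs M (s, True)) + card (pairs M (s, False))"
      using finite_pairs[OF M(2)] pairs_disjoint[OF M(2), of "(s, True)" "(s, False)"]
      by (intro card_Un_disjoint) simp_all
    moreover have "2 * card (pairs M (\<not> s, True)) + 2 * card (pairs M (\<not> s, False)) \<le> n"
      using card_side_blocks[of "\<not> s"] card_block[OF M(2), of "(\<not> s, True)"]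
        card_block[OF M(2), of "(\<not> s, False)"] by linarith
    moreover have "card M = card (pairs M (s, True)) + card (pairs M (s, False))
        + card (pairs M (\<not> s, True)) + card (pairs M (\<not> s, False))"
      using card_matching[OF M(2)] sum_bool_pair[of "\<lambda>k. card (pairs M k)" s True True] by simp
    ultimately show ?thesis using large_independent_matching[OF max] by linarith
  qed
  then show ?thesis using M(1) by blast
qed

end

section \<open>Linear functionals\<close>

definition fun_scale :: "bit \<Rightarrow> ('v \<Rightarrow> bit) \<Rightarrow> 'v \<Rightarrow> bit" where
  "fun_scale c f = (\<lambda>v. c * f v)"

interpretation functionals: binary_vector_space fun_scale
  by unfold_locales
    (auto simp: fun_scale_def fun_eq_iff algebra_simps simp del: add_bit_eq_xor mult_bit_eq_and)

text \<open>Vanishing outside the carrier makes equality of functionals on the carrier an equality of functions.\<close>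

definition functional :: "nat \<Rightarrow> (bit vec \<Rightarrow> bit) \<Rightarrow> bool" where
  "functional n f \<longleftrightarrow> (\<forall>v\<in>carrier_vec n. \<forall>w\<in>carrier_vec n. f (v + w) = f v + f w) \<and>
     (\<forall>v. v \<notin> carrier_vec n \<longrightarrow> f v = 0)"

lemma functional_add: "functional n f \<Longrightarrow> functional n g \<Longrightarrow> functional n (f + g)"
  unfolding functional_def by (simp add: ac_simps del: add_bit_eq_xor)

lemma functional_plus:
  "functional n f \<Longrightarrow> v \<in> carrier_vec n \<Longrightarrow> w \<in> carrier_vec n \<Longrightarrow> f (v + w) = f v + f w"
  unfolding functional_def by simp

text \<open>Induction on \<open>S\<close>. If \<open>p w = 1\<close> for some \<open>w\<close> in
  the kernel of \<open>S\<close>, then \<open>s w = 1\<close>, and adding \<open>w\<close> moves a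
  kernel vector with \<open>s v = 1\<close> into the kernel of \<open>s\<close>. So
  \<open>p + s\<close> vanishes on the kernel of \<open>S\<close>.\<close>

lemma in_span_if_kernel_subset:
  assumes "finite S" "\<And>s. s \<in> S \<Longrightarrow> functional n s" "functional n p"
    and "\<And>v. v \<in> carrier_vec n \<Longrightarrow> (\<And>s. s \<in> S \<Longrightarrow> s v = 0) \<Longrightarrow> p v = 0"
  shows "p \<in> functionals.span S"
  using assms
proof (induction S arbitrary: p)
  case empty
  have "p v = 0" for v
    using empty.prems(2) empty.prems(3)[of v] unfolding functional_def by auto
  then have "p = 0" by (simp add: fun_eq_iff)
  then show ?case using functionals.span_zero by (simp only:)
next
  case (insert s S)
  note s = insert.prems(1)[of s, simplified]
  show ?case
  proof (cases "\<forall>v\<in>carrier_vec n. (\<forall>t\<in>S. t v = 0) \<longrightarrow> p v = 0")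
    case True
    then have "p \<in> functionals.span S" using insert.IH[of p] insert.prems by simp
    then show ?thesis by (simp add: functionals.span_insert_iff)
  next
    case False
    then obtain w where w: "w \<in> carrier_vec n" "\<And>t. t \<in> S \<Longrightarrow> t w = 0" "p w = 1" by auto
    have "p + s \<in> functionals.span S"
    proof (rule insert.IH)
      show "functional n (p + s)" using functional_add insert.prems(2) s by blast
      show "functional n t" if "t \<in> S" for t using that insert.prems(1) by simp
      fix v assume v: "v \<in> carrier_vec n" "\<And>t. t \<in> S \<Longrightarrow> t v = 0"
      have sw: "s w = 1"
      proof (rule ccontr)
        assume "s w \<noteq> 1"
        then have "p w = 0" using w(2) by (intro insert.prems(3)[OF w(1)]) auto
        then show False using w(3) by simp
      qed
      show "(p + s) v = 0"
      proof (cases "s v = 0")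
        case True
        then have "p v = 0" using insert.prems(3)[OF v(1)] v(2) by blast
        then show ?thesis using True by simp
      next
        case False
        have "t (v + w) = 0" if "t \<in> insert s S" for t
        proof -
          have "t (v + w) = t v + t w"
            using functional_plus[OF insert.prems(1)[OF that] v(1) w(1)] .
          then show ?thesis using that v(2) w(2) False sw by (cases "t = s") simp_all
        qed
        then have "p (v + w) = 0" using insert.prems(3)[of "v + w"] v(1) w(1) by simp
        then have "p v + p w = 0" using functional_plus[OF insert.prems(2) v(1) w(1)] by simp
        then have "p v = 1" using w(3) by (cases "p v = 0") auto
        then show ?thesis using False by simp
      qed
    qed
    then show ?thesis by (simp add: functionals.span_insert_iff)
  qed
qed

text \<open>A vector \<open>w\<close> killed by all functionals of \<open>M\<close> but not by
  \<open>f p\<close> corrects the value at \<open>p\<close> and keeps the others.\<close>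

lemma independent_functionals_solvable:
  assumes "finite M" "functionals.independent_family f M" "\<And>k. k \<in> M \<Longrightarrow> functional n (f k)"
  shows "\<exists>v\<in>carrier_vec n. \<forall>k\<in>M. f k v = c k"
  using assms
proof (induction M)
  case empty
  show ?case by (auto intro: zero_carrier_vec)
next
  case (insert p M)
  have "functionals.independent_family f M"
    using functionals.independent_family_mono[OF insert.prems(1)] by blast
  then obtain v where v: "v \<in> carrier_vec n" "\<And>k. k \<in> M \<Longrightarrow> f k v = c k"
    using insert.IH insert.prems(2) by auto
  have "insert p M - {p} = M" using insert.hyps by simp
  then have "f p \<notin> functionals.span (f ` M)"
    using functionals.independent_family_notin_span[OF insert.prems(1), of p] by simp
  moreover have "f p \<in> functionals.span (f ` M)"
    if "\<forall>w\<in>carrier_vec n. (\<forall>k\<in>M. f k w = 0) \<longrightarrow> f p w = 0"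
    using that insert.hyps(1) insert.prems(2)
    by (intro in_span_if_kernel_subset[of "f ` M" n "f p"]) auto
  ultimately obtain w where w: "w \<in> carrier_vec n" "\<And>k. k \<in> M \<Longrightarrow> f k w = 0" "f p w \<noteq> 0"
    by blast
  show ?case
  proof (cases "f p v = c p")
    case True
    then show ?thesis using v by auto
  next
    case False
    have plus: "f k (v + w) = f k v + f k w" if "k \<in> insert p M" for k
      using functional_plus[OF insert.prems(2)[OF that] v(1) w(1)] .
    have "f p (v + w) = c p" using plus[of p] w(3) False by (cases "c p = 0") auto
    moreover have "f k (v + w) = c k" if "k \<in> M" for k
      using plus[of k] v(2) w(2) that by simp
    ultimately show ?thesis using v(1) w(1) by (intro bexI[of _ "v + w"]) auto
  qed
qed

lemma independent_family_if_dual: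
  assumes "\<And>i. i \<in> J \<Longrightarrow> f i (e i) = 1" "\<And>i j. i \<in> J \<Longrightarrow> j \<in> J \<Longrightarrow> i \<noteq> j \<Longrightarrow> f i (e j) = 0"
  shows "functionals.independent_family f J"
proof -
  have notin: "f j \<notin> functionals.span (f ` (J - {j}))" if j: "j \<in> J" for j
  proof
    have "functionals.subspace {g. g (e j) = 0}"
      by (auto simp: functionals.subspace_def fun_scale_def)
    then have "functionals.span (f ` (J - {j})) \<subseteq> {g. g (e j) = 0}"
      using assms(2)[OF _ j] by (intro functionals.span_minimal) auto
    moreover assume "f j \<in> functionals.span (f ` (J - {j}))"
    ultimately show False using assms(1)[OF j] by auto
  qed
  have "inj_on f J"
  proof (rule inj_onI, rule ccontr)
    fix i j assume "i \<in> J" "j \<in> J" "f i = f j" "i \<noteq> j"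
    then show False using assms(1)[of i] assms(2)[of j i] by simp
  qed
  moreover have "functionals.independent (f ` J)"
  proof
    assume "functionals.dependent (f ` J)"
    then obtain j where j: "j \<in> J" "f j \<in> functionals.span (f ` J - {f j})"
      unfolding functionals.dependent_def by blast
    have "f ` J - {f j} \<subseteq> f ` (J - {j})" by blast
    from functionals.span_mono[OF this] j notin[OF j(1)] show False by blast
  qed
  ultimately show ?thesis unfolding functionals.independent_family_def by simp
qed

section \<open>Hamming balls\<close>

lemma invertible_linear_map_add:
  assumes "invertible_linear_map n L" "v \<in> carrier_vec n" "w \<in> carrier_vec n"
  shows "L (v + w) = L v + L w"
proof -
  interpret linear_map class_ring "module_vec TYPE('a) n" "module_vec TYPE('a) n" L
    using assms(1) unfolding invertible_linear_map_def by simp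
  show ?thesis using f_add[of v w] assms(2,3) by (simp add: module_vec_simps)
qed

lemma invertible_linear_map_inv:
  assumes "invertible_linear_map n L"
  shows "v \<in> carrier_vec n \<Longrightarrow> L v \<in> carrier_vec n"
    and "v \<in> carrier_vec n \<Longrightarrow> inv_into (carrier_vec n) L v \<in> carrier_vec n"
    and "v \<in> carrier_vec n \<Longrightarrow> inv_into (carrier_vec n) L (L v) = v"
    and "v \<in> carrier_vec n \<Longrightarrow> L (inv_into (carrier_vec n) L v) = v"
  using assms unfolding invertible_linear_map_def
  by (auto simp: bij_betw_def inv_into_into f_inv_into_f)

lemma invertible_linear_map_inv_add:
  assumes L: "invertible_linear_map n L" and v: "v \<in> carrier_vec n" and w: "w \<in> carrier_vec n"
  shows "inv_into (carrier_vec n) L (v + w)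
    = inv_into (carrier_vec n) L v + inv_into (carrier_vec n) L w"
proof -
  let ?g = "inv_into (carrier_vec n) L"
  note inv = invertible_linear_map_inv[OF L]
  have "L (?g v + ?g w) = v + w"
    using invertible_linear_map_add[OF L inv(2)[OF v] inv(2)[OF w]] inv(4) v w by simp
  then have "?g (v + w) = ?g (L (?g v + ?g w))" by simp
  also have "\<dots> = ?g v + ?g w" using inv(2)[OF v] inv(2)[OF w] by (intro inv(3)) simp
  finally show ?thesis .
qed

text \<open>The assumption \<open>far\<close> is the bound \<open>n/2 - 7\<close> on the distance,
  cleared of fractions.\<close>

lemma notin_image_hamming_ball:
  assumes L: "invertible_linear_map n L" and X: "X \<in> carrier_vec n" and z: "z \<in> carrier_vec n"
    and r: "r < real n / 2 - 7"
    and far: "n \<le> 2 * hamming_dist X (inv_into (carrier_vec n) L z) + 14"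
  shows "z \<notin> L ` hamming_ball r X"
proof
  assume "z \<in> L ` hamming_ball r X"
  then obtain y where y: "y \<in> carrier_vec n" "real (hamming_dist X y) \<le> r" "z = L y"
    using X unfolding hamming_ball_def by auto
  then have "inv_into (carrier_vec n) L z = y" using invertible_linear_map_inv(3)[OF L] by simp
  then have "n \<le> 2 * hamming_dist X y + 14" using far by simp
  then show False using y(2) r by linarith
qed

text \<open>The dual basis to the columns of \<open>L\<close>, with the default 0 that
  \<open>functional\<close> requires.\<close>

definition coord :: "nat \<Rightarrow> (bit vec \<Rightarrow> bit vec) \<Rightarrow> nat \<Rightarrow> bit vec \<Rightarrow> bit" where
  "coord n L j v = (if v \<in> carrier_vec n then inv_into (carrier_vec n) L v $ j else 0)"

lemma functional_coord:
  assumes L: "invertible_linear_map n L" and "j < n"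
  shows "functional n (coord n L j)"
proof -
  have "coord n L j (v + w) = coord n L j v + coord n L j w"
    if "v \<in> carrier_vec n" "w \<in> carrier_vec n" for v w
  proof -
    have "inv_into (carrier_vec n) L w \<in> carrier_vec n"
      using invertible_linear_map_inv(2)[OF L that(2)] .
    then show ?thesis
      using that invertible_linear_map_inv_add[OF L that] assms(2)
      by (simp add: coord_def del: add_bit_eq_xor)
  qed
  then show ?thesis unfolding functional_def by (simp add: coord_def)
qed

lemma coord_unit_vec:
  assumes "invertible_linear_map n L" "i < n" "j < n"
  shows "coord n L i (L (unit_vec n j)) = (if i = j then 1 else 0)"
  using assms invertible_linear_map_inv(1,3)[OF assms(1), of "unit_vec n j"]
  by (simp add: coord_def)

lemma hamming_dist_add_one_vec:
  assumes "X \<in> carrier_vec n" "Y \<in> carrier_vec n"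
  shows "hamming_dist X Y + hamming_dist X (Y + vec n (\<lambda>_. 1 :: bit)) = n"
proof -
  let ?A = "{i. i < n \<and> X $ i \<noteq> Y $ i}" and ?B = "{i. i < n \<and> X $ i \<noteq> (Y + vec n (\<lambda>_. 1)) $ i}"
  have B: "?B = {i. i < n \<and> X $ i = Y $ i}"
  proof (intro Collect_cong conj_cong refl)
    fix i assume "i < n"
    then have "(Y + vec n (\<lambda>_. 1)) $ i = Y $ i + 1" using assms by (simp del: add_bit_eq_xor)
    then show "X $ i \<noteq> (Y + vec n (\<lambda>_. 1)) $ i \<longleftrightarrow> X $ i = Y $ i"
      by (cases "X $ i = 0"; cases "Y $ i = 0") auto
  qed
  have "card ?A + card ?B = card (?A \<union> ?B)"
    unfolding B by (intro card_Un_disjoint[symmetric]) auto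
  also have "?A \<union> ?B = {..<n}" unfolding B by auto
  finally show ?thesis using assms(1) unfolding hamming_dist_def by simp
qed

section \<open>A point outside all three balls\<close>

theorem mainTheorem3:
  "\<exists>n\<^sub>0. \<forall>n \<ge> n\<^sub>0. \<forall>r :: real. \<forall>L\<^sub>1 L\<^sub>2 L\<^sub>3 :: bit vec \<Rightarrow> bit vec. \<forall>x\<^sub>1 x\<^sub>2 x\<^sub>3.
     r < real n / 2 - 7 \<longrightarrow>
     invertible_linear_map n L\<^sub>1 \<longrightarrow> invertible_linear_map n L\<^sub>2 \<longrightarrow> invertible_linear_map n L\<^sub>3 \<longrightarrow>
     x\<^sub>1 \<in> carrier_vec n \<longrightarrow> x\<^sub>2 \<in> carrier_vec n \<longrightarrow> x\<^sub>3 \<in> carrier_vec n \<longrightarrow>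
     L\<^sub>1 ` hamming_ball r x\<^sub>1 \<union> L\<^sub>2 ` hamming_ball r x\<^sub>2 \<union> L\<^sub>3 ` hamming_ball r x\<^sub>3 \<noteq> carrier_vec n"
proof (intro exI[of _ 0] allI impI)
  \<comment> \<open>The threshold is 0 as the argument is uniform in \<open>n\<close>; for
    \<open>n \<le> 14\<close> the radius is negative.\<close>
  fix n :: nat and r :: real and L\<^sub>1 L\<^sub>2 L\<^sub>3 :: "bit vec \<Rightarrow> bit vec" and x\<^sub>1 x\<^sub>2 x\<^sub>3 :: "bit vec"
  assume r: "r < real n / 2 - 7"
    and L: "invertible_linear_map n L\<^sub>1" "invertible_linear_map n L\<^sub>2" "invertible_linear_map n L\<^sub>3"
    and x: "x\<^sub>1 \<in> carrier_vec n" "x\<^sub>2 \<in> carrier_vec n" "x\<^sub>3 \<in> carrier_vec n"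
  define K where "K s = (if s then L\<^sub>1 else L\<^sub>2)" for s
  define X where "X s = (if s then x\<^sub>1 else x\<^sub>2)" for s
  have K: "invertible_linear_map n (K s)" and X: "X s \<in> carrier_vec n" for s
    using L x unfolding K_def X_def by auto
  define one :: "bit vec" where "one = vec n (\<lambda>_. 1)"
  define u where "u = L\<^sub>3 one"
  have one: "one \<in> carrier_vec n" unfolding one_def by simp
  have u: "u \<in> carrier_vec n" unfolding u_def using invertible_linear_map_inv(1)[OF L(3) one] .
  define f where "f i = coord n (K (fst i)) (snd i)" for i
  \<comment> \<open>Paired functionals agree at \<open>u\<close>, so their sum takes the same value
    at \<open>v\<close> and at \<open>v + u\<close>.\<close>
  define cls where "cls i = (fst i, f i u = 1)" for i
  define I where "I = (UNIV :: bool set) \<times> {..<n}"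
  have side: "{i \<in> I. fst (cls i) = s} = {s} \<times> {..<n}" for s
    unfolding I_def cls_def by auto
  have f: "functional n (f i)" if "i \<in> I" for i
    using that functional_coord[OF K] unfolding f_def I_def by auto
  interpret P: two_sided_pairing fun_scale I f cls n
  proof unfold_locales
    show "finite I" unfolding I_def by simp
    show "card {i \<in> I. fst (cls i) = s} = n" for s unfolding side by simp
    show "functionals.independent_family f {i \<in> I. fst (cls i) = s}" for s
      unfolding side
      by (rule independent_family_if_dual[where e = "\<lambda>i. K s (unit_vec n (snd i))"])
        (auto simp: f_def coord_unit_vec[OF K] split: if_splits)
  qed
  obtain M where M: "P.good M" and large: "\<And>s. n \<le> 2 * card {p \<in> M. \<forall>i\<in>p. fst (cls i) = s} + 14"
    using P.balanced_independent_matching by blast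
  have mat: "P.matching M" and ind: "functionals.independent_family (sum f) M"
    using M P.good_def by auto
  have pair: "functional n (sum f p)" if "p \<in> M" for p
  proof -
    from P.matching_pair[OF mat that] obtain i j where "p = {i, j}" "i \<noteq> j" "i \<in> I" "j \<in> I"
      by iprover
    then show ?thesis using functional_add[OF f f, of i j] by simp
  qed
  \<comment> \<open>The summand 1 makes exactly one coordinate of each pair differ from the
    centre.\<close>
  have "\<exists>v\<in>carrier_vec n. \<forall>p\<in>M. sum f p v = 1 + (\<Sum>i\<in>p. X (fst i) $ snd i)"
    by (rule independent_functionals_solvable[OF P.finite_matching[OF mat] ind pair])
  then obtain v where v: "v \<in> carrier_vec n"
    and solve: "\<forall>p\<in>M. sum f p v = 1 + (\<Sum>i\<in>p. X (fst i) $ snd i)"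
    by (elim bexE)
  have far: "n \<le> 2 * hamming_dist (X s) (inv_into (carrier_vec n) (K s) z) + 14"
    if z: "z = v \<or> z = v + u" for s z
  proof -
    let ?M = "{p \<in> M. \<forall>i\<in>p. fst (cls i) = s}"
    have zc: "z \<in> carrier_vec n" using z v u by auto
    have "\<exists>i\<in>p. f i z \<noteq> X (fst i) $ snd i" if p: "p \<in> M" for p
    proof -
      from P.matching_pair[OF mat p] obtain i j
        where ij: "p = {i, j}" "i \<noteq> j" "i \<in> I" "j \<in> I" "cls i = cls j"
        by iprover
      have uu: "f i u = f j u" using ij(5) unfolding cls_def by (cases "f i u = 1") auto
      have "f i z + f j z = f i v + f j v"
        using z
      proof
        assume "z = v + u"
        then show ?thesis
          using functional_plus[OF f[OF ij(3)] v u] functional_plus[OF f[OF ij(4)] v u] uu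
          by (cases "f j u = 0"; cases "f i v = 0"; cases "f j v = 0") auto
      qed simp
      then have "f i z + f j z = 1 + (X (fst i) $ snd i + X (fst j) $ snd j)"
        using bspec[OF solve p] ij(1,2) by simp
      then show ?thesis
        unfolding ij(1) by (cases "f i z = 0"; cases "f j z = 0") auto
    qed
    then obtain g where g: "\<And>p. p \<in> M \<Longrightarrow> g p \<in> p"
      "\<And>p. p \<in> M \<Longrightarrow> f (g p) z \<noteq> X (fst (g p)) $ snd (g p)"
      by metis
    let ?Y = "{j. j < n \<and> X s $ j \<noteq> inv_into (carrier_vec n) (K s) z $ j}"
    have gs: "fst (g p) = s" "snd (g p) < n" if p: "p \<in> ?M" for p
    proof -
      have "g p \<in> I" using p g(1)[of p] P.matching_subset_Pow[OF mat] by blast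
      then show "snd (g p) < n" unfolding I_def by auto
      show "fst (g p) = s" using p g(1)[of p] unfolding cls_def by auto
    qed
    \<comment> \<open>Distinct pairs are disjoint, so their differing coordinates are
      distinct.\<close>
    have "card ?M \<le> card ?Y"
    proof (rule card_inj_on_le[where f = "\<lambda>p. snd (g p)"])
      show "inj_on (\<lambda>p. snd (g p)) ?M"
      proof (rule inj_onI, rule ccontr)
        fix p q assume pq: "p \<in> ?M" "q \<in> ?M" "snd (g p) = snd (g q)" "p \<noteq> q"
        then have "g p = g q" using gs(1)[OF pq(1)] gs(1)[OF pq(2)] by (simp add: prod_eq_iff)
        then show False
          using P.matching_disjoint[OF mat _ _ pq(4)] pq(1,2) g(1)[of p] g(1)[of q] by auto
      qed
      show "(\<lambda>p. snd (g p)) ` ?M \<subseteq> ?Y"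
      proof (rule image_subsetI)
        fix p assume p: "p \<in> ?M"
        then show "snd (g p) \<in> ?Y"
          using g(2)[of p] gs[OF p] zc unfolding f_def coord_def by auto
      qed
    qed simp
    then show ?thesis using large[of s] X[of s] unfolding hamming_dist_def by simp
  qed
  let ?h = "\<lambda>z. hamming_dist x\<^sub>3 (inv_into (carrier_vec n) L\<^sub>3 z)"
  have "inv_into (carrier_vec n) L\<^sub>3 (v + u) = inv_into (carrier_vec n) L\<^sub>3 v + one"
    using invertible_linear_map_inv_add[OF L(3) v u] invertible_linear_map_inv(3)[OF L(3) one]
    unfolding u_def by simp
  \<comment> \<open>Adding \<open>u\<close> complements the set of differing coordinates in the
    third basis, so one of both points is at distance at least \<open>n/2\<close>.\<close>
  then have "?h v + ?h (v + u) = n"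
    using hamming_dist_add_one_vec[OF x(3) invertible_linear_map_inv(2)[OF L(3) v]]
    unfolding one_def by simp
  then have "n \<le> 2 * ?h v + 14 \<or> n \<le> 2 * ?h (v + u) + 14" by linarith
  then obtain z where z: "z = v \<or> z = v + u" "n \<le> 2 * ?h z + 14" by blast
  have zc: "z \<in> carrier_vec n" using z(1) v u by auto
  have "z \<notin> L\<^sub>1 ` hamming_ball r x\<^sub>1"
    using notin_image_hamming_ball[OF L(1) x(1) zc r] far[OF z(1), of True]
    unfolding K_def X_def by simp
  moreover have "z \<notin> L\<^sub>2 ` hamming_ball r x\<^sub>2"
    using notin_image_hamming_ball[OF L(2) x(2) zc r] far[OF z(1), of False]
    unfolding K_def X_def by simp
  moreover have "z \<notin> L\<^sub>3 ` hamming_ball r x\<^sub>3"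
    using notin_image_hamming_ball[OF L(3) x(3) zc r z(2)] .
  ultimately show "L\<^sub>1 ` hamming_ball r x\<^sub>1 \<union> L\<^sub>2 ` hamming_ball r x\<^sub>2 \<union> L\<^sub>3 ` hamming_ball r x\<^sub>3
      \<noteq> carrier_vec n"
    using zc by blast
qed

end
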